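(* Let $\mathcal{A}$ be a non-trivial normal distributive $\nabla$-algebra with underlying set $A$. Then $\mathcal{A}$ is subdirectly irreducible if and only if there exists $x \in A\setminus\{1\}$ such that for every $y \in A\setminus\{1\}$ there exist a finite set $I$ and natural numbers $m_i, n_i \in \mathbb{N}$ (for $i \in I$) satisfying $\bigwedge_{i \in I} \nabla^{m_i}\Box^{n_i} y \leq x$. The same equivalence also holds for any non-trivial $\mathcal{A} \in \mathcal{V}_H(N)$, i.e., any non-trivial normal explicitly Heyting $\nabla$-algebra.
   Context: A $\nabla$-algebra is a tuple $\mathcal{A}=(\mathsf{A},\nabla,\to)$ where $\mathsf{A}=(A,\wedge,\vee,0,1)$ is a bounded lattice, $\nabla$ is a unary and $\to$ a binary operation on $A$, such that for all $a,b,c\in A$: $\nabla c\wedge a\leq b$ iff $c\leq a\to b$. Put $\Box a := 1\to a$. $\mathcal{A}$ is distributive if $\mathsf{A}$ is a distributive lattice; it is normal if $\nabla 1=1$ and $\nabla(a\wedge b)=\nabla a\wedge\nabla b$ for all $a,b\in A$. An explicitly Heyting $\nabla$-algebra is a structure $(\mathsf{A},\nabla,\to,\supset)$ where $(\mathsf{A},\nabla,\to)$ is a $\nabla$-algebra and $\supset$ is the Heyting implication on $\mathsf{A}$; $\mathcal{V}_H(N)$ is the class of those that are normal. A congruence relation on $\mathcal{A}$ is an equivalence relation on $A$ compatible with finite meets, finite joins, $\nabla$ and $\to$ (for explicitly Heyting $\nabla$-algebras, compatibility with $\supset$ is not required in the definition). $\mathcal{A}$ is trivial if it has exactly one element, and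 it is subdirectly irreducible if it is either trivial or has a least (with respect to inclusion) congruence among those different from the identity relation. $\mathbb{N}$ includes $0$; $\nabla^m$, $\Box^n$ denote iterates; an empty meet is $1$. *)

theory Defs
  imports Main
begin

unbundle lattice_syntax

text \<open>
  The bounded lattice is given by the type class, so the underlying set of an algebra is the
  whole type, and the constants \<open>\<bottom>\<close> and \<open>\<top>\<close> are the paper's \<open>0\<close> and \<open>1\<close>.
\<close>

locale nabla_algebra =
  fixes nabla :: "'a::bounded_lattice \<Rightarrow> 'a"
    and imp :: "'a \<Rightarrow> 'a \<Rightarrow> 'a"
  assumes adjunction: "nabla c \<sqinter> a \<le> b \<longleftrightarrow> c \<le> imp a b"

locale normal_nabla_algebra = nabla_algebra +
  assumes nabla_top: "nabla \<top> = \<top>"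
    and nabla_inf: "nabla (a \<sqinter> b) = nabla a \<sqinter> nabla b"

locale explicitly_heyting_nabla_algebra = nabla_algebra nabla imp
  for nabla :: "'a::bounded_lattice \<Rightarrow> 'a" and imp :: "'a \<Rightarrow> 'a \<Rightarrow> 'a" +
  fixes himp :: "'a \<Rightarrow> 'a \<Rightarrow> 'a"
  assumes heyting: "c \<sqinter> a \<le> b \<longleftrightarrow> c \<le> himp a b"

locale normal_explicitly_heyting_nabla_algebra =
  explicitly_heyting_nabla_algebra nabla imp himp + normal_nabla_algebra nabla imp
  for nabla :: "'a::bounded_lattice \<Rightarrow> 'a" and imp himp :: "'a \<Rightarrow> 'a \<Rightarrow> 'a"

definition box :: "('a::bounded_lattice \<Rightarrow> 'a \<Rightarrow> 'a) \<Rightarrow> 'a \<Rightarrow> 'a" where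
  "box imp a = imp \<top> a"

text \<open>
  Compatibility with the empty meet and the empty join is reflexivity at \<open>\<top>\<close> and \<open>\<bottom>\<close>.
  The Heyting implication of an explicitly Heyting algebra deliberately plays no role here.
\<close>

definition nabla_congruence ::
  "('a::bounded_lattice \<Rightarrow> 'a) \<Rightarrow> ('a \<Rightarrow> 'a \<Rightarrow> 'a) \<Rightarrow> 'a rel \<Rightarrow> bool" where
  "nabla_congruence nabla imp R \<longleftrightarrow>
     equiv UNIV R \<and>
     (\<forall>a b c d. (a, b) \<in> R \<longrightarrow> (c, d) \<in> R \<longrightarrow> (a \<sqinter> c, b \<sqinter> d) \<in> R) \<and>
     (\<forall>a b c d. (a, b) \<in> R \<longrightarrow> (c, d) \<in> R \<longrightarrow> (a \<squnion> c, b \<squnion> d) \<in> R) \<and>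
     (\<forall>a b. (a, b) \<in> R \<longrightarrow> (nabla a, nabla b) \<in> R) \<and>
     (\<forall>a b c d. (a, b) \<in> R \<longrightarrow> (c, d) \<in> R \<longrightarrow> (imp a c, imp b d) \<in> R)"

definition subdirectly_irreducible ::
  "('a::bounded_lattice \<Rightarrow> 'a) \<Rightarrow> ('a \<Rightarrow> 'a \<Rightarrow> 'a) \<Rightarrow> bool" where
  "subdirectly_irreducible nabla imp \<longleftrightarrow>
     is_singleton (UNIV :: 'a set) \<or>
     (\<exists>R. nabla_congruence nabla imp R \<and> R \<noteq> Id \<and>
          (\<forall>S. nabla_congruence nabla imp S \<and> S \<noteq> Id \<longrightarrow> R \<subseteq> S))"

text \<open>
  Finite meets with the convention that the empty meet is \<open>\<top>\<close>; the library's \<open>Inf_fin\<close> is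
  unspecified on the empty set and \<open>Inf\<close> needs a complete lattice.
  As for \<open>sum\<close>, the value on an infinite index set is the neutral element.
\<close>

global_interpretation finite_meet:
  comm_monoid_set "inf :: 'a::bounded_lattice \<Rightarrow> 'a \<Rightarrow> 'a" "top :: 'a"
  defines finite_meet = finite_meet.F
  by unfold_locales

end

theory Submission
  imports Defs "HOL-Library.Nat_Bijection"
begin

text \<open>
  A congruence is determined by the class of \<open>\<top>\<close>, which is a filter closed under \<open>\<nabla>\<close> and
  \<open>\<box>\<close>. Conversely such a filter \<open>F\<close> yields the congruence identifying \<open>a\<close> and \<open>b\<close> whenever
  \<open>a \<sqinter> f = b \<sqinter> f\<close> for some \<open>f \<in> F\<close>; compatibility with the implication comes from
  \<open>\<nabla> (\<box> f) \<le> f\<close>. So subdirect irreducibility says that some \<open>x \<noteq> \<top>\<close> lies in every closed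
  filter generated by one \<open>y \<noteq> \<top>\<close>. Normality and \<open>a \<le> \<box> (\<nabla> a)\<close> make this filter the up-set
  of the finite meets of the elements \<open>\<nabla>\<^sup>m \<box>\<^sup>n y\<close>.
\<close>

section \<open>Finite meets\<close>

lemma le_finite_meet_iff:
  fixes f :: "'i \<Rightarrow> 'a::bounded_lattice"
  assumes "finite I"
  shows "z \<le> finite_meet f I \<longleftrightarrow> (\<forall>i\<in>I. z \<le> f i)"
  using assms by (induction I) auto

text \<open>Preservation of \<open>\<top>\<close> covers the empty meet. Applied below to
  \<open>nabla\<close>, by normality, and to \<open>box imp\<close>, as a right adjoint.\<close>

lemma finite_meet_hom:
  fixes h :: "'a::bounded_lattice \<Rightarrow> 'a"
  assumes "finite I" "h \<top> = \<top>" "\<And>a b. h (a \<sqinter> b) = h a \<sqinter> h b"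
  shows "h (finite_meet f I) = finite_meet (\<lambda>i. h (f i)) I"
  using assms(1) by (induction I) (auto simp: assms(2,3))

lemma finite_meet_lower:
  fixes f :: "'i \<Rightarrow> 'a::bounded_lattice"
  assumes "finite I" "i \<in> I"
  shows "finite_meet f I \<le> f i"
  using le_finite_meet_iff[OF assms(1), of "finite_meet f I" f] assms(2) by blast

section \<open>Congruences and the relation induced by a set\<close>

lemma nabla_congruenceD:
  assumes "nabla_congruence nabla imp R"
  shows nabla_congruence_refl: "(a, a) \<in> R"
    and nabla_congruence_sym: "(a, b) \<in> R \<Longrightarrow> (b, a) \<in> R"
    and nabla_congruence_trans: "(a, b) \<in> R \<Longrightarrow> (b, c) \<in> R \<Longrightarrow> (a, c) \<in> R"
    and nabla_congruence_inf: "(a, b) \<in> R \<Longrightarrow> (c, d) \<in> R \<Longrightarrow> (a \<sqinter> c, b \<sqinter> d) \<in> R"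
    and nabla_congruence_sup: "(a, b) \<in> R \<Longrightarrow> (c, d) \<in> R \<Longrightarrow> (a \<squnion> c, b \<squnion> d) \<in> R"
    and nabla_congruence_nabla: "(a, b) \<in> R \<Longrightarrow> (nabla a, nabla b) \<in> R"
    and nabla_congruence_imp: "(a, b) \<in> R \<Longrightarrow> (c, d) \<in> R \<Longrightarrow> (imp a c, imp b d) \<in> R"
proof -
  have equiv: "equiv UNIV R"
    using assms by (simp add: nabla_congruence_def)
  show "(a, a) \<in> R"
    using equiv by (simp add: equiv_class_eq_iff)
  show "(a, b) \<in> R \<Longrightarrow> (b, a) \<in> R" "(a, b) \<in> R \<Longrightarrow> (b, c) \<in> R \<Longrightarrow> (a, c) \<in> R"
    using equiv by (simp_all add: equiv_class_eq_iff)
  show "(a, b) \<in> R \<Longrightarrow> (c, d) \<in> R \<Longrightarrow> (a \<sqinter> c, b \<sqinter> d) \<in> R"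
    and "(a, b) \<in> R \<Longrightarrow> (c, d) \<in> R \<Longrightarrow> (a \<squnion> c, b \<squnion> d) \<in> R"
    and "(a, b) \<in> R \<Longrightarrow> (nabla a, nabla b) \<in> R"
    and "(a, b) \<in> R \<Longrightarrow> (c, d) \<in> R \<Longrightarrow> (imp a c, imp b d) \<in> R"
    using assms by (simp_all add: nabla_congruence_def)
qed

definition filter_congruence :: "'a::bounded_lattice set \<Rightarrow> 'a rel" where
  "filter_congruence F = {(a, b). \<exists>f\<in>F. a \<sqinter> f = b \<sqinter> f}"

text \<open>Since \<open>f\<close> is related to \<open>\<top>\<close>, every \<open>u\<close> is
  related to \<open>u \<sqinter> f\<close>; chaining through
  \<open>a \<sqinter> f = b \<sqinter> f\<close> relates \<open>a\<close> to
  \<open>b\<close>.\<close>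

lemma filter_congruence_least:
  assumes S: "nabla_congruence nabla imp S" and F: "\<And>f. f \<in> F \<Longrightarrow> (f, \<top>) \<in> S"
  shows "filter_congruence F \<subseteq> S"
proof
  fix p assume "p \<in> filter_congruence F"
  then obtain a b f where p: "p = (a, b)" and f: "f \<in> F" "a \<sqinter> f = b \<sqinter> f"
    by (auto simp: filter_congruence_def)
  have meet: "(u \<sqinter> f, u) \<in> S" for u
  proof -
    have "(u \<sqinter> f, u \<sqinter> \<top>) \<in> S"
      using nabla_congruence_inf[OF S nabla_congruence_refl[OF S] F[OF f(1)]] .
    then show ?thesis by simp
  qed
  show "p \<in> S"
    using nabla_congruence_trans[OF S nabla_congruence_sym[OF S meet[of a]]] meet[of b] f(2) p
    by simp
qed

section \<open>Consequences of the adjunction\<close>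

context nabla_algebra
begin

text \<open>The instance \<open>a = \<top>\<close> of the adjunction makes \<open>box imp\<close>
  right adjoint to \<open>nabla\<close>; counit, unit and preservation of meets follow.\<close>

lemma box_adjunction: "nabla c \<le> b \<longleftrightarrow> c \<le> box imp b"
  using adjunction[of c \<top> b] by (simp add: box_def)

lemma nabla_box_le: "nabla (box imp a) \<le> a"
  by (simp add: box_adjunction)

lemma le_box_nabla: "a \<le> box imp (nabla a)"
  by (simp flip: box_adjunction)

lemma box_top: "box imp \<top> = \<top>"
  using box_adjunction[of \<top> \<top>] by (simp add: top_unique)

lemma box_inf: "box imp (a \<sqinter> b) = box imp a \<sqinter> box imp b"
proof (rule antisym)
  show "box imp (a \<sqinter> b) \<le> box imp a \<sqinter> box imp b"
    using nabla_box_le[of "a \<sqinter> b"] by (simp flip: box_adjunction)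
  have "nabla (box imp a \<sqinter> box imp b) \<le> a \<sqinter> b"
    by (rule le_infI) (simp_all add: box_adjunction)
  then show "box imp a \<sqinter> box imp b \<le> box imp (a \<sqinter> b)"
    by (simp only: box_adjunction)
qed

lemma nabla_imp_le: "nabla (imp a b) \<sqinter> a \<le> b"
  by (simp add: adjunction)

lemma imp_self: "imp a a = \<top>"
  using adjunction[of \<top> a a] by (simp add: top_unique)

end

section \<open>Filters closed under \<open>nabla\<close> and \<open>box imp\<close>\<close>

text \<open>The inductive form gives the least such filter with an induction rule, used both to find
  finite meets below its members and to place it inside the class of \<open>\<top>\<close> of a
  congruence.\<close>

inductive_set generated_filter ::
    "('a::bounded_lattice \<Rightarrow> 'a) \<Rightarrow> ('a \<Rightarrow> 'a \<Rightarrow> 'a) \<Rightarrow> 'a \<Rightarrow> 'a set"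
  for nabla :: "'a::bounded_lattice \<Rightarrow> 'a" and imp :: "'a \<Rightarrow> 'a \<Rightarrow> 'a" and y :: 'a
where
  base: "y \<in> generated_filter nabla imp y"
| upward: "a \<in> generated_filter nabla imp y \<Longrightarrow> a \<le> b \<Longrightarrow> b \<in> generated_filter nabla imp y"
| inf: "a \<in> generated_filter nabla imp y \<Longrightarrow> b \<in> generated_filter nabla imp y \<Longrightarrow>
    a \<sqinter> b \<in> generated_filter nabla imp y"
| nabla: "a \<in> generated_filter nabla imp y \<Longrightarrow> nabla a \<in> generated_filter nabla imp y"
| box: "a \<in> generated_filter nabla imp y \<Longrightarrow> box imp a \<in> generated_filter nabla imp y"

lemma top_in_generated_filter: "\<top> \<in> generated_filter nabla imp y"
  using generated_filter.upward[OF generated_filter.base top_greatest] .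

lemma funpow_in_generated_filter:
  "(nabla ^^ m) ((box imp ^^ n) y) \<in> generated_filter nabla imp y"
proof -
  have "(box imp ^^ n) y \<in> generated_filter nabla imp y"
    by (induction n) (auto intro: generated_filter.intros)
  then show ?thesis
    by (induction m) (auto intro: generated_filter.intros)
qed

lemma finite_meet_in_generated_filter:
  assumes "finite I" "\<And>i. i \<in> I \<Longrightarrow> f i \<in> generated_filter nabla imp y"
  shows "finite_meet f I \<in> generated_filter nabla imp y"
  using assms
  by (induction I) (auto intro: generated_filter.inf top_in_generated_filter)

section \<open>Members of the filter as upper bounds of finite meets\<close>

context normal_nabla_algebra
begin

text \<open>The elements above some such meet are closed under every generating rule:
  \<open>nabla\<close> and \<open>box imp\<close> act on a meet factor by factor, so it suffices to
  adjust the exponents.\<close>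

lemma generated_filter_imp_finite_meet:
  assumes "z \<in> generated_filter nabla imp y"
  obtains P where "finite P"
    "finite_meet (\<lambda>(m, n). (nabla ^^ m) ((box imp ^^ n) y)) P \<le> z"
proof -
  define g where "g = (\<lambda>(m, n). (nabla ^^ m) ((box imp ^^ n) y))"
  have "\<exists>P. finite P \<and> finite_meet g P \<le> z"
    using assms
  proof induction
    case base
    have "finite_meet g {(0, 0)} \<le> y"
      by (simp add: g_def)
    then show ?case by blast
  next
    case (upward a b)
    then show ?case by (meson order_trans)
  next
    case (inf a b)
    then obtain P Q where P: "finite P" "finite_meet g P \<le> a"
      and Q: "finite Q" "finite_meet g Q \<le> b" by blast
    have "finite_meet g (P \<union> Q) \<le> finite_meet g P" "finite_meet g (P \<union> Q) \<le> finite_meet g Q"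
      using P(1) Q(1) by (auto simp: le_finite_meet_iff finite_meet_lower)
    then have "finite_meet g (P \<union> Q) \<le> a \<sqinter> b"
      using P(2) Q(2) by (meson le_inf_iff order_trans)
    then show ?case using P(1) Q(1) by blast
  next
    case (nabla a)
    then obtain P where P: "finite P" "finite_meet g P \<le> a" by blast
    let ?Q = "(\<lambda>(m, n). (Suc m, n)) ` P"
    have "finite_meet g ?Q \<le> finite_meet (\<lambda>p. nabla (g p)) P"
      unfolding le_finite_meet_iff[OF P(1)]
    proof
      fix p assume "p \<in> P"
      then have "finite_meet g ?Q \<le> g (case p of (m, n) \<Rightarrow> (Suc m, n))"
        using P(1) by (intro finite_meet_lower) auto
      then show "finite_meet g ?Q \<le> nabla (g p)"
        by (cases p) (simp add: g_def)
    qed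
    also have "\<dots> = nabla (finite_meet g P)"
      using finite_meet_hom[of P nabla g, OF P(1) nabla_top nabla_inf] by (rule sym)
    \<comment> \<open>Preservation of binary meets yields monotonicity.\<close>
    also have "\<dots> \<le> nabla a"
      using P(2) nabla_inf[of "finite_meet g P" a] by (simp add: inf_absorb1 le_iff_inf)
    finally show ?case using P(1) by blast
  next
    case (box a)
    then obtain P where P: "finite P" "finite_meet g P \<le> a" by blast
    \<comment> \<open>For \<open>m > 0\<close> the unit \<open>le_box_nabla\<close> cancels the box
      against the outermost \<open>nabla\<close>, at the price of an inequality; for
      \<open>m = 0\<close> the box joins the inner power.\<close>
    define s where "s = (\<lambda>(m::nat, n::nat). if m = 0 then (0, Suc n) else (m - 1, n))"
    have step: "g (s p) \<le> box imp (g p)" for p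
    proof (cases p)
      case (Pair m n)
      then show ?thesis
        by (cases m) (auto simp: g_def s_def le_box_nabla)
    qed
    have "finite_meet g (s ` P) \<le> finite_meet (\<lambda>p. box imp (g p)) P"
      unfolding le_finite_meet_iff[OF P(1)]
    proof
      fix p assume "p \<in> P"
      then have "finite_meet g (s ` P) \<le> g (s p)"
        using P(1) by (intro finite_meet_lower) auto
      then show "finite_meet g (s ` P) \<le> box imp (g p)"
        using step order_trans by blast
    qed
    also have "\<dots> = box imp (finite_meet g P)"
      using finite_meet_hom[of P "box imp" g, OF P(1) box_top box_inf] by (rule sym)
    also have "\<dots> \<le> box imp a"
      using P(2) box_inf[of "finite_meet g P" a] by (simp add: inf_absorb1 le_iff_inf)
    finally show ?case using P(1) by blast
  qed
  then show thesis
    using that by (auto simp: g_def)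
qed

lemma generated_filter_iff:
  "z \<in> generated_filter nabla imp y \<longleftrightarrow>
    (\<exists>(I :: nat set) (m :: nat \<Rightarrow> nat) (n :: nat \<Rightarrow> nat). finite I \<and>
      finite_meet (\<lambda>i. (nabla ^^ m i) ((box imp ^^ n i) y)) I \<le> z)"
proof
  assume "z \<in> generated_filter nabla imp y"
  then obtain P where P: "finite P"
      "finite_meet (\<lambda>(m, n). (nabla ^^ m) ((box imp ^^ n) y)) P \<le> z"
    by (rule generated_filter_imp_finite_meet)
  \<comment> \<open>The code of a pair of exponents serves as its index; injectivity of the encoding
    leaves the meet unchanged.\<close>
  let ?m = "\<lambda>i. fst (prod_decode i)" and ?n = "\<lambda>i. snd (prod_decode i)"
  have "finite_meet (\<lambda>i. (nabla ^^ ?m i) ((box imp ^^ ?n i) y)) (prod_encode ` P) \<le> z"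
    using P(2) by (simp add: finite_meet.reindex inj_prod_encode case_prod_beta comp_def)
  then show "\<exists>(I :: nat set) (m :: nat \<Rightarrow> nat) (n :: nat \<Rightarrow> nat). finite I \<and>
      finite_meet (\<lambda>i. (nabla ^^ m i) ((box imp ^^ n i) y)) I \<le> z"
    using P(1) by (intro exI[of _ "prod_encode ` P"] exI[of _ ?m] exI[of _ ?n] conjI finite_imageI)
next
  assume "\<exists>(I :: nat set) (m :: nat \<Rightarrow> nat) (n :: nat \<Rightarrow> nat). finite I \<and>
      finite_meet (\<lambda>i. (nabla ^^ m i) ((box imp ^^ n i) y)) I \<le> z"
  then obtain I :: "nat set" and m n :: "nat \<Rightarrow> nat" where "finite I"
      and le: "finite_meet (\<lambda>i. (nabla ^^ m i) ((box imp ^^ n i) y)) I \<le> z"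
    by (elim exE conjE)
  then show "z \<in> generated_filter nabla imp y"
    by (intro generated_filter.upward[OF _ le] finite_meet_in_generated_filter
        funpow_in_generated_filter)
qed

section \<open>From filters to congruences\<close>

text \<open>By adjunction and normality it suffices to bound
  \<open>nabla (imp a c) \<sqinter> nabla (box imp f) \<sqinter> b\<close>. The counit replaces the
  middle factor by \<open>f\<close>, which turns \<open>b\<close> into \<open>a\<close>; detachment
  then gives \<open>c \<sqinter> f = d \<sqinter> f\<close>. Thus \<open>box imp f\<close> witnesses
  compatibility with \<open>imp\<close>.\<close>

lemma filter_congruence_imp_le:
  assumes "a \<sqinter> f = b \<sqinter> f" "c \<sqinter> f = d \<sqinter> f"
  shows "imp a c \<sqinter> box imp f \<le> imp b d"
proof -
  have "nabla (imp a c) \<sqinter> nabla (box imp f) \<sqinter> b \<le> nabla (imp a c) \<sqinter> (b \<sqinter> f)"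
    using nabla_box_le[of f] by (simp add: le_infI1 le_infI2)
  also have "\<dots> = nabla (imp a c) \<sqinter> a \<sqinter> f"
    by (simp add: inf_assoc flip: assms(1))
  also have "\<dots> \<le> c \<sqinter> f"
    using inf_mono[OF nabla_imp_le order_refl] .
  also have "\<dots> \<le> d"
    by (simp add: assms(2))
  finally show ?thesis
    by (simp add: nabla_inf flip: adjunction)
qed

text \<open>Distributivity, used for joins, is an explicit assumption so that it can come either
  from the type class or from a Heyting implication.\<close>

lemma nabla_congruence_generated:
  fixes y :: 'a
  assumes distrib: "\<And>a b c :: 'a. (a \<squnion> b) \<sqinter> c = (a \<sqinter> c) \<squnion> (b \<sqinter> c)"
  shows "nabla_congruence nabla imp (filter_congruence (generated_filter nabla imp y))"
proof -
  let ?F = "generated_filter nabla imp y"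
  let ?R = "filter_congruence ?F"
  have weaken: "a \<sqinter> (f \<sqinter> g) = b \<sqinter> (f \<sqinter> g)" "a \<sqinter> (g \<sqinter> f) = b \<sqinter> (g \<sqinter> f)"
    if "a \<sqinter> f = b \<sqinter> f" for a b f g :: 'a
    proof -
    show "a \<sqinter> (f \<sqinter> g) = b \<sqinter> (f \<sqinter> g)"
      using that by (simp flip: inf_assoc)
    then show "a \<sqinter> (g \<sqinter> f) = b \<sqinter> (g \<sqinter> f)"
      by (simp only: inf_commute[of g f])
  qed
  \<comment> \<open>The meet of two witnesses stays in the filter and serves both pairs.\<close>
  have common: "\<exists>f\<in>?F. a \<sqinter> f = b \<sqinter> f \<and> c \<sqinter> f = d \<sqinter> f"
    if "(a, b) \<in> ?R" "(c, d) \<in> ?R" for a b c d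
    using that weaken generated_filter.inf unfolding filter_congruence_def by blast
  have sym: "(b, a) \<in> ?R" if "(a, b) \<in> ?R" for a b
    using that by (auto simp: filter_congruence_def intro: sym)
  have refl: "(a, a) \<in> ?R" for a
    using generated_filter.base by (auto simp: filter_congruence_def)
  have trans: "(a, c) \<in> ?R" if "(a, b) \<in> ?R" "(b, c) \<in> ?R" for a b c
    using common[OF that] by (auto simp: filter_congruence_def)
  have equiv: "equiv UNIV ?R"
  proof (rule equivI)
    show "refl_on UNIV ?R" by (rule refl_onI) (use refl in simp)
    show "sym ?R" by (rule symI) (rule sym)
    show "trans ?R" by (rule transI) (rule trans)
  qed simp
  have inf: "(a \<sqinter> c, b \<sqinter> d) \<in> ?R" if "(a, b) \<in> ?R" "(c, d) \<in> ?R" for a b c d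
  proof -
    obtain f where f: "f \<in> ?F" "a \<sqinter> f = b \<sqinter> f" "c \<sqinter> f = d \<sqinter> f"
      using common[OF \<open>(a, b) \<in> ?R\<close> \<open>(c, d) \<in> ?R\<close>] by blast
    have "a \<sqinter> c \<sqinter> f = (a \<sqinter> f) \<sqinter> (c \<sqinter> f)"
      by (simp add: inf_aci)
    also have "\<dots> = b \<sqinter> d \<sqinter> f"
      by (simp add: f(2,3) inf_aci)
    finally show ?thesis
      using f(1) by (auto simp: filter_congruence_def)
  qed
  have sup: "(a \<squnion> c, b \<squnion> d) \<in> ?R" if "(a, b) \<in> ?R" "(c, d) \<in> ?R" for a b c d
  proof -
    obtain f where f: "f \<in> ?F" "a \<sqinter> f = b \<sqinter> f" "c \<sqinter> f = d \<sqinter> f"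
      using common[OF \<open>(a, b) \<in> ?R\<close> \<open>(c, d) \<in> ?R\<close>] by blast
    have "(a \<squnion> c) \<sqinter> f = (b \<squnion> d) \<sqinter> f"
      by (simp only: distrib f(2,3))
    then show ?thesis
      using f(1) by (auto simp: filter_congruence_def)
  qed
  have nabla: "(nabla a, nabla b) \<in> ?R" if "(a, b) \<in> ?R" for a b
  proof -
    obtain f where f: "f \<in> ?F" "a \<sqinter> f = b \<sqinter> f"
      using \<open>(a, b) \<in> ?R\<close> by (auto simp: filter_congruence_def)
    have "nabla a \<sqinter> nabla f = nabla b \<sqinter> nabla f"
      using f(2) by (simp flip: nabla_inf)
    then show ?thesis
      using generated_filter.nabla[OF f(1)] by (auto simp: filter_congruence_def)
  qed
  have imp: "(imp a c, imp b d) \<in> ?R" if "(a, b) \<in> ?R" "(c, d) \<in> ?R" for a b c d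
  proof -
    obtain f where f: "f \<in> ?F" "a \<sqinter> f = b \<sqinter> f" "c \<sqinter> f = d \<sqinter> f"
      using common[OF \<open>(a, b) \<in> ?R\<close> \<open>(c, d) \<in> ?R\<close>] by blast
    have "imp a c \<sqinter> box imp f = imp b d \<sqinter> box imp f"
      using filter_congruence_imp_le[OF f(2,3)] filter_congruence_imp_le[OF f(2,3)[symmetric]]
      by (intro antisym) auto
    then show ?thesis
      using generated_filter.box[OF f(1)] by (auto simp: filter_congruence_def)
  qed
  show ?thesis
    unfolding nabla_congruence_def
    by (intro conjI allI impI equiv inf sup nabla imp)
qed

section \<open>Classes of \<open>\<top>\<close>\<close>

text \<open>A witness \<open>f\<close> for \<open>z\<close> and \<open>\<top>\<close> satisfies
  \<open>f \<le> z\<close>, so upward closure applies; conversely \<open>z\<close> is its own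
  witness.\<close>

lemma top_class_generated:
  "(z, \<top>) \<in> filter_congruence (generated_filter nabla imp y) \<longleftrightarrow> z \<in> generated_filter nabla imp y"
proof
  assume "(z, \<top>) \<in> filter_congruence (generated_filter nabla imp y)"
  then obtain f where "f \<in> generated_filter nabla imp y" "z \<sqinter> f = f"
    by (auto simp: filter_congruence_def)
  then show "z \<in> generated_filter nabla imp y"
    by (metis generated_filter.upward inf_le1)
next
  assume "z \<in> generated_filter nabla imp y"
  then show "(z, \<top>) \<in> filter_congruence (generated_filter nabla imp y)"
    unfolding filter_congruence_def by (auto intro!: bexI[of _ z])
qed

lemma generated_filter_subset_top_class:
  assumes S: "nabla_congruence nabla imp S" and y: "(y, \<top>) \<in> S"
    and z: "z \<in> generated_filter nabla imp y"
  shows "(z, \<top>) \<in> S"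
  using z
proof induction
  case base
  show ?case by (rule y)
next
  case (upward a b)
  \<comment> \<open>As \<open>a \<le> b\<close>, joining with \<open>b\<close> turns the pair of
    \<open>a\<close> and \<open>\<top>\<close> into that of \<open>b\<close> and
    \<open>\<top>\<close>.\<close>
  have "(a \<squnion> b, \<top> \<squnion> b) \<in> S"
    using nabla_congruence_sup[OF S upward.IH nabla_congruence_refl[OF S]] .
  then show ?case using upward by (simp add: sup_absorb2)
next
  case (inf a b)
  have "(a \<sqinter> b, \<top> \<sqinter> \<top>) \<in> S"
    using nabla_congruence_inf[OF S inf.IH] .
  then show ?case by simp
next
  case (nabla a)
  have "(nabla a, nabla \<top>) \<in> S"
    using nabla_congruence_nabla[OF S nabla.IH] .
  then show ?case by (simp add: nabla_top)
next
  case (box a)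
  have "(imp \<top> a, imp \<top> \<top>) \<in> S"
    using nabla_congruence_imp[OF S nabla_congruence_refl[OF S] box.IH] .
  then show ?case by (simp add: box_def imp_self)
qed

text \<open>For related \<open>a \<noteq> b\<close>, both \<open>imp a b\<close> and
  \<open>imp b a\<close> are related to \<open>\<top>\<close>. They cannot both equal
  \<open>\<top>\<close>: as \<open>nabla \<top> = \<top>\<close>, that would force
  \<open>a \<le> b\<close> and \<open>b \<le> a\<close>.\<close>

lemma nontrivial_congruence_top_class:
  assumes S: "nabla_congruence nabla imp S" and "S \<noteq> Id"
  obtains y where "y \<noteq> \<top>" "(y, \<top>) \<in> S"
proof -
  obtain a b where ab: "(a, b) \<in> S" "a \<noteq> b"
    using \<open>S \<noteq> Id\<close> nabla_congruence_refl[OF S] by auto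
  have imp_top: "(imp u v, \<top>) \<in> S" if "(u, v) \<in> S" for u v
  proof -
    have "(imp u v, imp v v) \<in> S"
      using nabla_congruence_imp[OF S that nabla_congruence_refl[OF S]] .
    then show ?thesis by (simp add: imp_self)
  qed
  have "u \<le> v" if "imp u v = \<top>" for u v
    using nabla_imp_le[of u v] that by (simp add: nabla_top)
  then have "imp a b \<noteq> \<top> \<or> imp b a \<noteq> \<top>"
    using ab(2) antisym by blast
  then show thesis
    using that imp_top ab(1) nabla_congruence_sym[OF S] by blast
qed

section \<open>The criterion for subdirect irreducibility\<close>

theorem subdirectly_irreducible_iff:
  assumes distrib: "\<And>a b c :: 'a. (a \<squnion> b) \<sqinter> c = (a \<sqinter> c) \<squnion> (b \<sqinter> c)"
    and nontrivial: "\<not> is_singleton (UNIV :: 'a set)"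
  shows "subdirectly_irreducible nabla imp \<longleftrightarrow>
    (\<exists>x. x \<noteq> \<top> \<and> (\<forall>y. y \<noteq> \<top> \<longrightarrow> x \<in> generated_filter nabla imp y))"
proof
  assume "subdirectly_irreducible nabla imp"
  then obtain R where R: "nabla_congruence nabla imp R" "R \<noteq> Id"
    and least: "\<And>S. nabla_congruence nabla imp S \<Longrightarrow> S \<noteq> Id \<Longrightarrow> R \<subseteq> S"
    using nontrivial unfolding subdirectly_irreducible_def by blast
  obtain x where x: "x \<noteq> \<top>" "(x, \<top>) \<in> R"
    using nontrivial_congruence_top_class[OF R] .
  have "x \<in> generated_filter nabla imp y" if "y \<noteq> \<top>" for y
  proof -
    \<comment> \<open>This congruence relates \<open>y\<close> to \<open>\<top>\<close>, hence
      contains the least one \<open>R\<close> and with it the pair of \<open>x\<close> and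
      \<open>\<top>\<close>.\<close>
    have "filter_congruence (generated_filter nabla imp y) \<noteq> Id"
      using top_class_generated[of y y] generated_filter.base that by auto
    then show ?thesis
      using least[OF nabla_congruence_generated[OF distrib, of y]] x(2) top_class_generated
      by blast
  qed
  then show "\<exists>x. x \<noteq> \<top> \<and> (\<forall>y. y \<noteq> \<top> \<longrightarrow> x \<in> generated_filter nabla imp y)"
    using x(1) by blast
next
  assume "\<exists>x. x \<noteq> \<top> \<and> (\<forall>y. y \<noteq> \<top> \<longrightarrow> x \<in> generated_filter nabla imp y)"
  then obtain x where x: "x \<noteq> \<top>" "\<And>y. y \<noteq> \<top> \<Longrightarrow> x \<in> generated_filter nabla imp y"
    by blast
  \<comment> \<open>Candidate for the least congruence: any other nontrivial one relates some
    \<open>y \<noteq> \<top>\<close> to \<open>\<top>\<close>, hence also \<open>x\<close>, hence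
    the whole filter of \<open>x\<close>.\<close>
  let ?R = "filter_congruence (generated_filter nabla imp x)"
  have "?R \<noteq> Id"
    using top_class_generated[of x x] generated_filter.base x(1) by auto
  moreover have "?R \<subseteq> S" if S: "nabla_congruence nabla imp S" "S \<noteq> Id" for S
  proof -
    obtain y where "y \<noteq> \<top>" "(y, \<top>) \<in> S"
      using nontrivial_congruence_top_class[OF S] .
    then have "(x, \<top>) \<in> S"
      using generated_filter_subset_top_class[OF S(1)] x(2) by blast
    then show ?thesis
      using filter_congruence_least[OF S(1)] generated_filter_subset_top_class[OF S(1)] by blast
  qed
  ultimately show "subdirectly_irreducible nabla imp"
    unfolding subdirectly_irreducible_def
    using nabla_congruence_generated[OF distrib, of x] by blast
qed

end

text \<open>Meeting with \<open>c\<close> is left adjoint to \<open>himp c\<close>, and left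
  adjoints preserve joins.\<close>

lemma (in explicitly_heyting_nabla_algebra) inf_sup_distrib_heyting:
  fixes a b c :: 'a
  shows "(a \<squnion> b) \<sqinter> c = (a \<sqinter> c) \<squnion> (b \<sqinter> c)"
proof (rule antisym)
  have "a \<squnion> b \<le> himp c ((a \<sqinter> c) \<squnion> (b \<sqinter> c))"
    by (rule sup_least) (simp_all flip: heyting)
  then show "(a \<squnion> b) \<sqinter> c \<le> (a \<sqinter> c) \<squnion> (b \<sqinter> c)"
    by (simp only: heyting)
  show "(a \<sqinter> c) \<squnion> (b \<sqinter> c) \<le> (a \<squnion> b) \<sqinter> c"
    by (simp add: le_infI1)
qed

theorem corollary4p11:
  fixes nabla :: "'a::{bounded_lattice, distrib_lattice} \<Rightarrow> 'a"
    and imp :: "'a \<Rightarrow> 'a \<Rightarrow> 'a"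
    and nabla' :: "'b::bounded_lattice \<Rightarrow> 'b"
    and imp' himp' :: "'b \<Rightarrow> 'b \<Rightarrow> 'b"
  shows
    "(normal_nabla_algebra nabla imp \<and> \<not> is_singleton (UNIV :: 'a set) \<longrightarrow>
       (subdirectly_irreducible nabla imp \<longleftrightarrow>
         (\<exists>x. x \<noteq> \<top> \<and> (\<forall>y. y \<noteq> \<top> \<longrightarrow>
           (\<exists>(I :: nat set) (m :: nat \<Rightarrow> nat) (n :: nat \<Rightarrow> nat). finite I \<and>
              finite_meet (\<lambda>i. (nabla ^^ m i) ((box imp ^^ n i) y)) I \<le> x))))) \<and>
     (normal_explicitly_heyting_nabla_algebra nabla' imp' himp' \<and>
        \<not> is_singleton (UNIV :: 'b set) \<longrightarrow>
       (subdirectly_irreducible nabla' imp' \<longleftrightarrow>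
         (\<exists>x. x \<noteq> \<top> \<and> (\<forall>y. y \<noteq> \<top> \<longrightarrow>
           (\<exists>(I :: nat set) (m :: nat \<Rightarrow> nat) (n :: nat \<Rightarrow> nat). finite I \<and>
              finite_meet (\<lambda>i. (nabla' ^^ m i) ((box imp' ^^ n i) y)) I \<le> x)))))"
proof (intro conjI impI; elim conjE)
  assume alg: "normal_nabla_algebra nabla imp" and "\<not> is_singleton (UNIV :: 'a set)"
  then show "subdirectly_irreducible nabla imp \<longleftrightarrow>
      (\<exists>x. x \<noteq> \<top> \<and> (\<forall>y. y \<noteq> \<top> \<longrightarrow>
        (\<exists>(I :: nat set) (m :: nat \<Rightarrow> nat) (n :: nat \<Rightarrow> nat). finite I \<and>
           finite_meet (\<lambda>i. (nabla ^^ m i) ((box imp ^^ n i) y)) I \<le> x)))"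
    \<comment> \<open>Folding the finite meets back into filter membership leaves exactly the filter
      criterion.\<close>
    unfolding normal_nabla_algebra.generated_filter_iff[OF alg, symmetric]
    by (intro normal_nabla_algebra.subdirectly_irreducible_iff inf_sup_distrib2)
next
  assume "normal_explicitly_heyting_nabla_algebra nabla' imp' himp'"
    and nontrivial: "\<not> is_singleton (UNIV :: 'b set)"
  then interpret normal_explicitly_heyting_nabla_algebra nabla' imp' himp' by simp
  show "subdirectly_irreducible nabla' imp' \<longleftrightarrow>
      (\<exists>x. x \<noteq> \<top> \<and> (\<forall>y. y \<noteq> \<top> \<longrightarrow>
        (\<exists>(I :: nat set) (m :: nat \<Rightarrow> nat) (n :: nat \<Rightarrow> nat). finite I \<and>
           finite_meet (\<lambda>i. (nabla' ^^ m i) ((box imp' ^^ n i) y)) I \<le> x)))"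
    unfolding generated_filter_iff[symmetric]
    \<comment> \<open>The same criterion applies, with distributivity now supplied by the Heyting
      implication.\<close>
    by (intro subdirectly_irreducible_iff inf_sup_distrib_heyting nontrivial)
qed

end
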